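(* Let $\mathcal{H}$ be a real Hilbert space with norm $\|\cdot\|$. Let $(|\cdot|_k)_{k\in\mathbb{N}}$ be a sequence of Hilbert norms on $\mathcal{H}$ such that the sequence of the associated positive operators is strongly (that is, pointwise) convergent in $(\mathcal{H},\|\cdot\|)$, and suppose that there exists $\nu>0$ such that $\nu\|\cdot\|^2\le|\cdot|_k^2$ for every $k\in\mathbb{N}$. Let $h\colon\mathcal{H}\to\left]-\infty,+\infty\right]$ be proper convex lower semicontinuous, let $(x_k)_{k\in\mathbb{N}}$ be a sequence in $\operatorname{dom}h$, and set $S_*=\operatorname{argmin}_{\mathcal{H}}h$. Suppose that (A) $(h(x_k))_{k\in\mathbb{N}}$ is decreasing, and that, if $\inf_{k\in\mathbb{N}}h(x_k)>-\infty$, then both of the following are satisfied for some $(\alpha_k)_{k\in\mathbb{N}}$ and $(y_k)_{k\in\mathbb{N}}$: (B) $(\alpha_k)_{k\in\mathbb{N}}$ is a sequence in $\left]0,+\infty\right[$ with $\sup_k\alpha_k<+\infty$, and there exist summable sequences $(\eta_k)_{k\in\mathbb{N}}$ and $(\varepsilon_k)_{k\in\mathbb{N}}$ in $[0,+\infty[$ such that, for all $x\in\operatorname{dom}h$ and all $k\in\mathbb{N}$, $$|x_{k+1}-x|_{k+1}^2\le(1+\eta_k)|x_k-x|_k^2+2\alpha_k\big(h(x)-h(x_{k+1})\big)+\varepsilon_k;$$ (C) $(y_k)_{k\in\mathbb{N}}$ is a sequence in $\mathcal{H}$ and there exists a sequence $(v_k)_{k\in\mathbb{N}}$ in $\mathcal{H}$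 such that $v_k\in\partial h(y_k)$ for every $k\in\mathbb{N}$ and, for every weakly convergent subsequence $(x_{n_k})_{k\in\mathbb{N}}$ of $(x_k)_{k\in\mathbb{N}}$, $x_{n_k}-y_{n_k}\rightharpoonup0$ and $v_{n_k}\to0$. Then the following hold. (i) If $\inf_{k\in\mathbb{N}}h(x_k)>-\infty$, then $\sum_{k\in\mathbb{N}}\|x_{k+1}-x_k\|^2<+\infty$. (ii) Suppose that $S_*\neq\varnothing$. Then (a) $(x_k)_{k\in\mathbb{N}}$ and $(y_k)_{k\in\mathbb{N}}$ weakly converge to the same point in $S_*$; (b) $h(y_k)\to\inf_{\mathcal{H}}h$; (c) if $\sum_{k\in\mathbb{N}}\alpha_k=+\infty$, then $h(x_k)\to\inf_{\mathcal{H}}h$; (d) if $\inf_{k\in\mathbb{N}}\alpha_k>0$, then $h(x_k)-\inf_{\mathcal{H}}h=o(1/k)$. (iii) If $S_*=\varnothing$, then $\|x_k\|\to+\infty$ and $h(x_k)\to\inf_{\mathcal{H}}h$.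
   Context: "Decreasing" means nonincreasing. A Hilbert norm on $\mathcal{H}$ is a norm induced by a scalar product on $\mathcal{H}$; the associated positive operator of $|\cdot|_k$ is the operator $V_k\colon\mathcal{H}\to\mathcal{H}$ such that the scalar product inducing $|\cdot|_k$ equals $\langle x\mid V_ky\rangle$, where $\langle\cdot\mid\cdot\rangle$ is the scalar product of $\mathcal{H}$. $\partial h$ is the convex subdifferential with respect to $\langle\cdot\mid\cdot\rangle$; $\rightharpoonup$ and $\to$ denote weak and strong convergence in $\mathcal{H}$. *)

theory Defs
  imports "HOL-Analysis.Analysis" "HOL-Library.Landau_Symbols"
begin

definition is_scalar_product :: "('a::real_vector \<Rightarrow> 'a \<Rightarrow> real) \<Rightarrow> bool" where
  "is_scalar_product B \<longleftrightarrow>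
     bilinear B \<and> (\<forall>x y. B x y = B y x) \<and> (\<forall>x. 0 \<le> B x x) \<and> (\<forall>x. B x x = 0 \<longleftrightarrow> x = 0)"

definition induces_norm :: "('a::real_vector \<Rightarrow> 'a \<Rightarrow> real) \<Rightarrow> ('a \<Rightarrow> real) \<Rightarrow> bool" where
  "induces_norm B N \<longleftrightarrow> is_scalar_product B \<and> (\<forall>x. N x = sqrt (B x x))"

definition hilbert_norm :: "('a::real_vector \<Rightarrow> real) \<Rightarrow> bool" where
  "hilbert_norm N \<longleftrightarrow> (\<exists>B. induces_norm B N)"

(* The inducing scalar product is determined by N (polarization), hence so is V. An everywhere
   defined V of this kind is automatically linear, symmetric, positive and, on a complete space,
   bounded (Hellinger-Toeplitz), so none of this is required separately. *)
definition associated_operator :: "('a::real_inner \<Rightarrow> real) \<Rightarrow> ('a \<Rightarrow> 'a) \<Rightarrow> bool" where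
  "associated_operator N V \<longleftrightarrow> (\<exists>B. induces_norm B N \<and> (\<forall>x y. B x y = inner x (V y)))"

(* By the Riesz representation theorem, testing against the functionals inner z suffices
   on a Hilbert space. *)
definition weakly_tendsto :: "(nat \<Rightarrow> 'a::real_inner) \<Rightarrow> 'a \<Rightarrow> bool" where
  "weakly_tendsto u p \<longleftrightarrow> (\<forall>z. (\<lambda>k. inner z (u k)) \<longlonglongrightarrow> inner z p)"

definition edom :: "('a \<Rightarrow> ereal) \<Rightarrow> 'a set" where
  "edom h = {x. h x < \<infinity>}"

definition proper_fun :: "('a \<Rightarrow> ereal) \<Rightarrow> bool" where
  "proper_fun h \<longleftrightarrow> (\<forall>x. h x \<noteq> -\<infinity>) \<and> edom h \<noteq> {}"

definition convex_ereal :: "('a::real_vector \<Rightarrow> ereal) \<Rightarrow> bool" where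
  "convex_ereal h \<longleftrightarrow>
     (\<forall>x y t. 0 < t \<and> t < 1 \<longrightarrow>
        h ((1 - t) *\<^sub>R x + t *\<^sub>R y) \<le> ereal (1 - t) * h x + ereal t * h y)"

definition lsc :: "('a::topological_space \<Rightarrow> ereal) \<Rightarrow> bool" where
  "lsc h \<longleftrightarrow> (\<forall>x. h x \<le> Liminf (nhds x) h)"

definition argmin :: "('a \<Rightarrow> ereal) \<Rightarrow> 'a set" where
  "argmin h = {x. is_arg_min h (\<lambda>_. True) x}"

definition subdifferential :: "('a::real_inner \<Rightarrow> ereal) \<Rightarrow> 'a \<Rightarrow> 'a set" where
  "subdifferential h y = {v. \<forall>z. h y + ereal (inner (z - y) v) \<le> h z}"

end

theory Submission
  imports Defs "HOL-Library.Diagonal_Subsequence"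
begin

text \<open>Inequality (B) makes \<open>|x\<^sub>k - z|\<^sub>k\<^sup>2\<close> almost decreasing, hence convergent, whenever
  \<open>h z \<le> h (x\<^sub>k)\<close> for all \<open>k\<close>; used with \<open>z = x\<^sub>k\<close> instead, it telescopes and gives (i).
  Every weak cluster point of \<open>x\<close> minimizes \<open>h\<close>: there the subgradients \<open>v\<close> vanish and \<open>h\<close> is weakly
  lower semicontinuous. If minimizers exist, Opial's argument in the variable metric shows that there is
  only one cluster point, and the remaining terms of (B) make \<open>\<alpha>\<^sub>k (h (x\<^sub>k\<^sub>+\<^sub>1) - min h)\<close> summable.
  If there are none, \<open>x\<close> has no weakly convergent subsequence, and a point \<open>z\<close> with \<open>h z < inf\<^sub>k h (x\<^sub>k)\<close>
  would make it bounded.\<close>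

subsection \<open>Weak convergence in Hilbert spaces\<close>

text \<open>Baire category: the closed sets \<open>C n\<close> cover the complete space, so one of
  them contains a ball, and a bound for the functionals on a ball bounds their norms.\<close>

lemma uniform_boundedness_inner:
  fixes W :: "'a::{real_inner, complete_space} set"
  assumes "\<And>z. \<exists>M. \<forall>w\<in>W. \<bar>inner z w\<bar> \<le> M"
  shows "\<exists>M>0. \<forall>w\<in>W. norm w \<le> M"
proof -
  define C where "C n = {z. \<forall>w\<in>W. \<bar>inner z w\<bar> \<le> real n}" for n
  have "closed (C n)" for n
  proof -
    have "C n = (\<Inter>w\<in>W. {z. \<bar>inner z w\<bar> \<le> real n})"
      by (auto simp: C_def)
    then show ?thesis
      by (auto intro!: closed_INT closed_Collect_le continuous_intros)
  qed
  moreover have "\<Union>(range C) = UNIV"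
  proof -
    have "\<exists>n. z \<in> C n" for z
    proof -
      obtain M where M: "\<forall>w\<in>W. \<bar>inner z w\<bar> \<le> M" using assms by blast
      moreover obtain n where "M \<le> real n" using real_arch_simple by blast
      ultimately have "z \<in> C n" by (force simp: C_def)
      then show ?thesis ..
    qed
    then show ?thesis by auto
  qed
  ultimately have "\<exists>n. interior (C n) \<noteq> {}"
    using Baire_category_alt[of "euclidean :: 'a topology" "range C"] completely_metrizable_space_euclidean
    by fastforce
  then obtain n p where "p \<in> interior (C n)" by auto
  then obtain e where e: "e > 0" "cball p e \<subseteq> C n"
    by (auto simp: mem_interior_cball)
  \<comment> \<open>Moving from \<open>p\<close> by the length \<open>e\<close> in the direction of
    \<open>w\<close> stays in \<open>C n\<close>, so \<open>e * norm w\<close> is a difference of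
    two numbers of size at most \<open>n\<close>. The summand 1 keeps the bound positive when
    \<open>n = 0\<close>.\<close>
  have "norm w \<le> (2 * real n + 1) / e" if "w \<in> W" for w
  proof (cases "w = 0")
    case False
    define q where "q = p + (e / norm w) *\<^sub>R w"
    have "q \<in> cball p e" using False e(1) by (simp add: q_def dist_norm)
    then have "\<bar>inner q w\<bar> \<le> real n" using e(2) that by (auto simp: C_def)
    moreover have "\<bar>inner p w\<bar> \<le> real n"
      using e that centre_in_cball[of p e] unfolding C_def by force
    moreover have "inner q w = inner p w + e * norm w"
      using False by (simp add: q_def inner_add_left power2_norm_eq_inner[symmetric] power2_eq_square)
    ultimately have "e * norm w \<le> 2 * real n" by linarith
    then show ?thesis using e(1) by (simp add: field_simps)
  qed (use e in simp)
  moreover have "(2 * real n + 1) / e > 0" using e by simp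
  ultimately show ?thesis by blast
qed

lemma weakly_tendsto_imp_bounded:
  fixes u :: "nat \<Rightarrow> 'a::{real_inner, complete_space}"
  assumes "weakly_tendsto u p"
  shows "\<exists>M>0. \<forall>n. norm (u n) \<le> M"
proof -
  have "\<exists>M. \<forall>w\<in>range u. \<bar>inner z w\<bar> \<le> M" for z
  proof -
    have "Bseq (\<lambda>n. inner z (u n))"
      using assms by (intro convergent_imp_Bseq) (auto simp: weakly_tendsto_def convergent_def)
    then show ?thesis by (auto simp: Bseq_def)
  qed
  from uniform_boundedness_inner[OF this] show ?thesis by auto
qed

text \<open>The representing vector is the limit of a minimizing sequence of \<open>\<parallel>z\<parallel>\<^sup>2 - 2 L z\<close>.\<close>
lemma riesz_on_subspace:
  fixes E :: "'a::{real_inner, complete_space} set" and L :: "'a \<Rightarrow> real"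
  assumes "subspace E"
    and add: "\<And>a b. a \<in> E \<Longrightarrow> b \<in> E \<Longrightarrow> L (a + b) = L a + L b"
    and scale: "\<And>a t. a \<in> E \<Longrightarrow> L (t *\<^sub>R a) = t * L a"
    and bound: "\<And>a. a \<in> E \<Longrightarrow> \<bar>L a\<bar> \<le> M * norm a"
  shows "\<exists>p\<in>closure E. \<forall>a\<in>E. inner a p = L a"
proof -
  define f where "f z = (norm z)\<^sup>2 - 2 * L z" for z
  define d where "d = (INF z\<in>E. f z)"
  have "- (M\<^sup>2) \<le> f z" if "z \<in> E" for z
  proof -
    have "0 \<le> (norm z - M)\<^sup>2" by simp
    then show ?thesis using bound[OF that] by (simp add: f_def power2_eq_square algebra_simps)
  qed
  then have bdd: "bdd_below (f ` E)" by (auto intro!: bdd_belowI)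
  have E0: "E \<noteq> {}" using assms(1) subspace_0 by auto
  have d_le: "d \<le> f z" if "z \<in> E" for z
    unfolding d_def using bdd that by (rule cINF_lower)
  have "\<exists>z\<in>E. f z < d + 1 / real (Suc n)" for n
    unfolding d_def by (subst cINF_less_iff[OF E0 bdd, symmetric]) simp
  then obtain u where u: "\<And>n. u n \<in> E" "\<And>n. f (u n) < d + 1 / real (Suc n)" by metis
  \<comment> \<open>Parallelogram law, with \<open>f\<close> at the midpoint bounded below by
    \<open>d\<close>: near-minimizers of \<open>f\<close> are close to each other.\<close>
  have par: "(norm (a - b))\<^sup>2 \<le> 2 * (f a + f b - 2 * d)" if "a \<in> E" "b \<in> E" for a b
  proof -
    have ab: "a + b \<in> E" using that assms(1) by (simp add: subspace_add)
    have "d \<le> f ((1/2) *\<^sub>R (a + b))"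
      using ab assms(1) by (intro d_le) (simp add: subspace_scale)
    also have "\<dots> = (norm (a + b))\<^sup>2 / 4 - (L a + L b)"
      using scale[OF ab] add[OF that] by (simp add: f_def power_divide add_divide_distrib)
    finally show ?thesis
      by (simp add: f_def power2_norm_eq_inner inner_commute algebra_simps)
  qed
  have "Cauchy u"
  proof (rule metric_CauchyI)
    fix e :: real assume "e > 0"
    then obtain K where K: "1 / real (Suc K) < e\<^sup>2 / 4"
      using nat_approx_posE[of "e\<^sup>2 / 4"] by auto
    have "dist (u m) (u n) < e" if "m \<ge> K" "n \<ge> K" for m n
    proof -
      have "1 / real (Suc m) \<le> 1 / real (Suc K)" "1 / real (Suc n) \<le> 1 / real (Suc K)"
        using that by (auto simp: field_simps)
      then have "f (u m) < d + e\<^sup>2 / 4" "f (u n) < d + e\<^sup>2 / 4"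
        using u(2)[of m] u(2)[of n] K by (meson add_left_mono less_trans le_less_trans less_le_trans add_strict_left_mono)+
      then have "2 * (f (u m) + f (u n) - 2 * d) < e\<^sup>2" by argo
      then have "(norm (u m - u n))\<^sup>2 < e\<^sup>2"
        using par[OF u(1)[of m] u(1)[of n]] by (rule order.strict_trans1[rotated])
      then show ?thesis using \<open>e > 0\<close> by (simp add: dist_norm power2_less_imp_less)
    qed
    then show "\<exists>K. \<forall>m\<ge>K. \<forall>n\<ge>K. dist (u m) (u n) < e" by blast
  qed
  then obtain p where p: "u \<longlonglongrightarrow> p" using Cauchy_convergent convergent_def by blast
  have "inner a p = L a" if a: "a \<in> E" for a
  proof -
    define c where "c = inner a p - L a"
    \<comment> \<open>First variation of \<open>f\<close> at the near-minimizers \<open>u n\<close>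
      in the direction \<open>a\<close>, with \<open>n\<close> sent to infinity afterwards.
      \<open>f\<close> is not evaluated at \<open>p\<close>, which may lie outside \<open>E\<close>,
      where nothing is known about \<open>L\<close>.\<close>
    have quad: "0 \<le> 2 * t * c + t\<^sup>2 * (norm a)\<^sup>2" for t
    proof -
      have "0 \<le> 1 / real (Suc n) + (2 * t * (inner a (u n) - L a) + t\<^sup>2 * (norm a)\<^sup>2)" for n
      proof -
        have ta: "t *\<^sub>R a \<in> E" using a assms(1) by (simp add: subspace_scale)
        have "d \<le> f (u n + t *\<^sub>R a)"
          using u(1) ta assms(1) by (intro d_le) (simp add: subspace_add)
        also have "\<dots> = f (u n) + (2 * t * (inner a (u n) - L a) + t\<^sup>2 * (norm a)\<^sup>2)"
          using add[OF u(1) ta] scale[OF a] unfolding f_def power2_norm_eq_inner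
          by (simp add: inner_add_left inner_add_right inner_commute algebra_simps power2_eq_square)
        finally show ?thesis using u(2)[of n] by linarith
      qed
      moreover have "(\<lambda>n. 1 / real (Suc n) + (2 * t * (inner a (u n) - L a) + t\<^sup>2 * (norm a)\<^sup>2))
          \<longlonglongrightarrow> 0 + (2 * t * (inner a p - L a) + t\<^sup>2 * (norm a)\<^sup>2)"
        by (intro tendsto_intros p LIMSEQ_Suc[OF lim_1_over_n])
      ultimately show ?thesis unfolding c_def by (auto intro: LIMSEQ_le_const)
    qed
    show ?thesis
    proof (cases "a = 0")
      case True
      then show ?thesis using scale[OF a, of 0] by simp
    next
      case False
      \<comment> \<open>The chosen \<open>t\<close> minimizes the quadratic polynomial; its least
        value is \<open>- c\<^sup>2 / (norm a)\<^sup>2\<close>.\<close>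
      then have "0 \<le> - (c\<^sup>2)"
        using quad[of "- c / (norm a)\<^sup>2"] by (simp add: field_simps power2_eq_square)
      then show ?thesis by (simp add: c_def)
    qed
  qed
  moreover have "p \<in> closure E" using p u(1) closure_sequential by blast
  ultimately show ?thesis by blast
qed

text \<open>Replacing \<open>z\<close> by a nearby \<open>a\<close> in \<open>E\<close> changes the
  products by an amount that is small uniformly in \<open>n\<close>, because \<open>s\<close> is
  bounded.\<close>

lemma tendsto_inner_closure:
  fixes s :: "nat \<Rightarrow> 'a::real_inner"
  assumes M: "\<And>n. norm (s n) \<le> M"
    and p: "\<And>a. a \<in> E \<Longrightarrow> (\<lambda>n. inner a (s n)) \<longlonglongrightarrow> inner a p"
    and z: "z \<in> closure E"
  shows "(\<lambda>n. inner z (s n)) \<longlonglongrightarrow> inner z p"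
proof (rule LIMSEQ_I)
  fix r :: real assume r: "r > 0"
  have M0: "M \<ge> 0" using M[of 0] norm_ge_zero order_trans by blast
  define e where "e = r / (2 * (M + norm p + 1))"
  have pos: "M + norm p + 1 > 0" using M0 by (simp add: add_nonneg_pos)
  then have "e > 0" using r by (simp add: e_def)
  then obtain a where a: "a \<in> E" "dist a z < e" using z closure_approachable by blast
  obtain K where K: "\<forall>n\<ge>K. norm (inner a (s n) - inner a p) < r / 2"
    using LIMSEQ_D[OF p[OF a(1)], of "r / 2"] r by auto
  have "norm (inner z (s n) - inner z p) < r" if "n \<ge> K" for n
  proof -
    have "inner z (s n) - inner z p = inner (z - a) (s n - p) + (inner a (s n) - inner a p)"
      by (simp add: inner_diff_left inner_diff_right)
    moreover have "\<bar>inner (z - a) (s n - p)\<bar> \<le> norm (z - a) * norm (s n - p)"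
      by (rule Cauchy_Schwarz_ineq2)
    moreover have "norm (z - a) * norm (s n - p) \<le> e * (M + norm p + 1)"
    proof (intro mult_mono)
      show "norm (s n - p) \<le> M + norm p + 1"
        using norm_triangle_ineq4[of "s n" p] M[of n] by linarith
    qed (use a \<open>e > 0\<close> in \<open>auto simp: dist_norm norm_minus_commute\<close>)
    moreover have "e * (M + norm p + 1) = r / 2" using pos by (simp add: e_def del: distrib_left_numeral)
    ultimately show ?thesis using K that by fastforce
  qed
  then show "\<exists>K. \<forall>n\<ge>K. norm (inner z (s n) - inner z p) < r" by blast
qed

text \<open>A diagonal subsequence makes the products with the countably many \<open>u n\<close>
  converge, hence those with their span \<open>E\<close>. The limit functional is represented by
  some \<open>p\<close> in \<open>closure E\<close>, and any other vector acts on the subsequence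
  and on \<open>p\<close> like its projection onto \<open>closure E\<close>.\<close>

lemma bounded_imp_weakly_convergent_subsequence:
  fixes u :: "nat \<Rightarrow> 'a::{real_inner, complete_space}"
  assumes M: "\<And>n. norm (u n) \<le> M"
  shows "\<exists>r p. strict_mono r \<and> weakly_tendsto (\<lambda>k. u (r k)) p"
proof -
  interpret subseqs "\<lambda>n r. convergent (\<lambda>k. inner (u n) (u (r k)))"
  proof
    fix n and s :: "nat \<Rightarrow> nat"
    have "bounded (range (\<lambda>k. inner (u n) (u (s k))))"
    proof (rule boundedI)
      show "norm a \<le> norm (u n) * M" if "a \<in> range (\<lambda>k. inner (u n) (u (s k)))" for a
      proof -
        from that obtain k where "a = inner (u n) (u (s k))" by auto
        then have "norm a \<le> norm (u n) * norm (u (s k))" using Cauchy_Schwarz_ineq2 by auto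
        also have "\<dots> \<le> norm (u n) * M" by (intro mult_left_mono M) simp
        finally show ?thesis .
      qed
    qed
    then obtain l r where "strict_mono r" "((\<lambda>k. inner (u n) (u (s k))) \<circ> r) \<longlonglongrightarrow> l"
      using bounded_imp_convergent_subsequence by blast
    then show "\<exists>r'. strict_mono r' \<and> convergent (\<lambda>k. inner (u n) (u ((s \<circ> r') k)))"
      by (auto simp: convergent_def o_def)
  qed
  define s where "s k = u (diagseq k)" for k
  have sM: "norm (s k) \<le> M" for k by (simp add: s_def M)
  have gen: "convergent (\<lambda>k. inner (u n) (s k))" for n
  proof -
    \<comment> \<open>Only from index \<open>Suc n\<close> on is the diagonal sequence a subsequence
      of the one chosen for \<open>u n\<close>; the shift does not affect convergence.\<close>
    have "convergent (\<lambda>k. inner (u n) (u ((diagseq \<circ> (+) (Suc n)) k)))"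
    proof (rule diagseq_holds)
      fix r s' :: "nat \<Rightarrow> nat" and m
      assume "strict_mono r" "convergent (\<lambda>k. inner (u m) (u (s' k)))"
      then show "convergent (\<lambda>k. inner (u m) (u ((s' \<circ> r) k)))"
        using convergent_subseq_convergent[of "\<lambda>k. inner (u m) (u (s' k))" r] by (simp add: o_def)
    qed
    then have "convergent (\<lambda>k. inner (u n) (s (k + Suc n)))"
      by (simp add: s_def o_def add.commute)
    then show ?thesis by (subst (asm) convergent_ignore_initial_segment)
  qed
  define E where "E = span (range u)"
  have subE: "subspace E" by (simp add: E_def)
  have conv: "convergent (\<lambda>k. inner a (s k))" if "a \<in> E" for a
    using that unfolding E_def
  proof (induction rule: span_induct_alt)
    case base
    then show ?case by (simp add: convergent_const)
  next
    case (step c x y)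
    then show ?case using gen
      by (auto simp: inner_add_left intro!: convergent_add convergent_mult convergent_const)
  qed
  define L where "L a = lim (\<lambda>k. inner a (s k))" for a
  have L: "(\<lambda>k. inner a (s k)) \<longlonglongrightarrow> L a" if "a \<in> E" for a
    using conv[OF that] by (simp add: L_def convergent_LIMSEQ_iff)
  have "\<exists>p\<in>closure E. \<forall>a\<in>E. inner a p = L a"
  proof (rule riesz_on_subspace[OF subE])
    fix a b assume "a \<in> E" "b \<in> E"
    then have "(\<lambda>k. inner (a + b) (s k)) \<longlonglongrightarrow> L a + L b"
      by (simp add: inner_add_left tendsto_add L)
    then show "L (a + b) = L a + L b" by (simp add: L_def limI)
  next
    fix a t assume "a \<in> E"
    then have "(\<lambda>k. inner (t *\<^sub>R a) (s k)) \<longlonglongrightarrow> t * L a"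
      by (simp add: tendsto_mult_left L)
    then show "L (t *\<^sub>R a) = t * L a" by (simp add: L_def limI)
  next
    fix a assume "a \<in> E"
    have "\<bar>inner a (s k)\<bar> \<le> M * norm a" for k
      using Cauchy_Schwarz_ineq2[of a "s k"] mult_left_mono[OF sM[of k], of "norm a"]
      by (simp add: mult.commute)
    then show "\<bar>L a\<bar> \<le> M * norm a"
      using tendsto_rabs[OF L[OF \<open>a \<in> E\<close>]] by (auto intro: LIMSEQ_le_const2)
  qed
  then obtain p where p: "p \<in> closure E" "\<And>a. a \<in> E \<Longrightarrow> inner a p = L a" by blast
  have lim_cl: "(\<lambda>k. inner z (s k)) \<longlonglongrightarrow> inner z p" if "z \<in> closure E" for z
    using tendsto_inner_closure[OF sM _ that] L p(2) by simp
  have "(\<lambda>k. inner z (s k)) \<longlonglongrightarrow> inner z p" for z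
  proof -
    \<comment> \<open>\<open>q\<close> is the orthogonal projection of \<open>z\<close> onto
      \<open>closure E\<close>, obtained by representing the functional \<open>inner a z\<close> on
      \<open>E\<close>.\<close>
    have "\<exists>q\<in>closure E. \<forall>a\<in>E. inner a q = inner a z"
    proof (rule riesz_on_subspace[OF subE])
      show "\<bar>inner a z\<bar> \<le> norm z * norm a" for a
        using Cauchy_Schwarz_ineq2[of a z] by (simp add: mult.commute)
    qed (simp_all add: inner_add_left)
    then obtain q where q: "q \<in> closure E" "\<And>a. a \<in> E \<Longrightarrow> inner a (q - z) = 0"
      by (auto simp: inner_diff_right)
    have "closure E \<subseteq> {a. inner a (q - z) = 0}"
      using q(2) by (intro closure_minimal closed_Collect_eq continuous_intros) auto
    then have "inner p (q - z) = 0" using p(1) by blast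
    then have "inner z p = inner q p" by (simp add: inner_diff_right inner_commute)
    moreover have "inner z (s k) = inner q (s k)" for k
    proof -
      have "s k \<in> E" unfolding s_def E_def by (intro span_base) simp
      then show ?thesis using q(2)[of "s k"] by (simp add: inner_diff_right inner_commute)
    qed
    ultimately show ?thesis using lim_cl[OF q(1)] by simp
  qed
  then have "weakly_tendsto (\<lambda>k. u (diagseq k)) p" by (simp add: weakly_tendsto_def s_def)
  then show ?thesis using subseq_diagseq by blast
qed

text \<open>A near-closest point \<open>q\<close> of \<open>C\<close> to \<open>p\<close> satisfies the variational inequality of the projection up
  to a small error; testing it with the sequence shows that the distance of \<open>p\<close> to \<open>C\<close> vanishes.\<close>
lemma closed_convex_imp_weakly_closed:
  fixes C :: "'a::{real_inner, complete_space} set"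
  assumes "closed C" "convex C" and ev: "eventually (\<lambda>n. u n \<in> C) sequentially"
    and w: "weakly_tendsto u p"
  shows "p \<in> C"
proof -
  obtain M where M: "M > 0" "\<And>n. norm (u n) \<le> M"
    using weakly_tendsto_imp_bounded[OF w] by blast
  have C0: "C \<noteq> {}" using ev by (auto dest: eventually_happens)
  define d where "d = infdist p C"
  \<comment> \<open>\<open>K\<close> bounds \<open>norm (c - q)\<close> whenever
    \<open>norm c \<le> M\<close> and \<open>q\<close> is within \<open>d + 1\<close> of
    \<open>p\<close>.\<close>
  define K where "K = M + norm p + d + 1"
  have d0: "d \<ge> 0" by (simp add: d_def infdist_nonneg)
  have small: "2 * t * d\<^sup>2 \<le> \<delta> + t\<^sup>2 * K\<^sup>2" if t: "0 < t" "t < 1" and \<delta>: "0 < \<delta>" for t \<delta> :: real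
  proof -
    \<comment> \<open>This choice gives \<open>(d + e)\<^sup>2 \<le> d\<^sup>2 + \<delta>\<close>,
      as \<open>e * (2 * d + e) \<le> e * (2 * d + 1) \<le> \<delta>\<close>.\<close>
    define e where "e = min 1 (\<delta> / (2 * d + 1))"
    have e: "0 < e" "e \<le> 1" "e \<le> \<delta> / (2 * d + 1)"
      using \<delta> d0 by (auto simp: e_def)
    have e\<delta>: "e * (2 * d + 1) \<le> \<delta>" using e(3) d0 by (simp add: pos_le_divide_eq)
    have "\<exists>q\<in>C. dist p q < d + e"
      using C0 e(1) cINF_less_iff[OF C0, of "dist p" "d + e"] by (simp add: d_def infdist_def)
    then obtain q where q: "q \<in> C" "dist p q < d + e" by blast
    have "(dist p q)\<^sup>2 \<le> (d + e)\<^sup>2" using q by (intro power_mono) auto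
    also have "\<dots> = d\<^sup>2 + e * (2 * d + e)" by (simp add: power2_eq_square algebra_simps)
    also have "\<dots> \<le> d\<^sup>2 + e * (2 * d + 1)" using e by (intro add_left_mono mult_left_mono) auto
    finally have q2: "(norm (p - q))\<^sup>2 \<le> d\<^sup>2 + \<delta>" using e\<delta> by (simp add: dist_norm)
    \<comment> \<open>The point with parameter \<open>t\<close> on the segment from \<open>q\<close>
      to \<open>c\<close> lies in \<open>C\<close>, so its distance from \<open>p\<close> is at
      least \<open>d\<close>; the claim follows by expanding the square.\<close>
    have le: "2 * t * inner (p - q) (c - q) \<le> \<delta> + t\<^sup>2 * K\<^sup>2" if c: "c \<in> C" "norm c \<le> M" for c
    proof -
      have "(1 - t) *\<^sub>R q + t *\<^sub>R c \<in> C" using c q t assms(2) by (intro convexD) auto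
      then have "d \<le> dist p ((1 - t) *\<^sub>R q + t *\<^sub>R c)" unfolding d_def by (rule infdist_le)
      then have "d\<^sup>2 \<le> (dist p ((1 - t) *\<^sub>R q + t *\<^sub>R c))\<^sup>2" using d0 by (intro power_mono)
      also have "p - ((1 - t) *\<^sub>R q + t *\<^sub>R c) = (p - q) - t *\<^sub>R (c - q)" by (simp add: algebra_simps)
      then have "(dist p ((1 - t) *\<^sub>R q + t *\<^sub>R c))\<^sup>2
          = (norm (p - q))\<^sup>2 - 2 * t * inner (p - q) (c - q) + t\<^sup>2 * (norm (c - q))\<^sup>2"
        unfolding dist_norm by (simp only: power2_norm_eq_inner)
          (simp add: inner_diff_left inner_diff_right inner_commute algebra_simps power2_eq_square)
      moreover have "(norm (c - q))\<^sup>2 \<le> K\<^sup>2"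
      proof (rule power_mono)
        have "norm (c - q) \<le> norm c + norm p + norm (p - q)"
          using norm_triangle_ineq4[of c q] norm_triangle_ineq4[of p "p - q"] by simp
        then show "norm (c - q) \<le> K" using c q e by (simp add: K_def dist_norm)
      qed simp
      then have "t\<^sup>2 * (norm (c - q))\<^sup>2 \<le> t\<^sup>2 * K\<^sup>2" by (intro mult_left_mono) auto
      ultimately show ?thesis using q2 by linarith
    qed
    have "(\<lambda>n. 2 * t * (inner (p - q) (u n) - inner (p - q) q)) \<longlonglongrightarrow>
        2 * t * (inner (p - q) p - inner (p - q) q)"
      using w by (intro tendsto_mult tendsto_diff tendsto_const) (simp add: weakly_tendsto_def)
    then have "2 * t * (inner (p - q) p - inner (p - q) q) \<le> \<delta> + t\<^sup>2 * K\<^sup>2"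
      by (rule tendsto_upperbound) (use ev le M in \<open>auto elim!: eventually_mono simp: inner_diff_right\<close>)
    moreover have "inner (p - q) p - inner (p - q) q = (norm (p - q))\<^sup>2"
      by (simp add: power2_norm_eq_inner inner_diff_right)
    moreover have "d\<^sup>2 \<le> (norm (p - q))\<^sup>2"
      using d0 infdist_le[OF q(1), of p] by (intro power_mono) (auto simp: d_def dist_norm)
    then have "2 * t * d\<^sup>2 \<le> 2 * t * (norm (p - q))\<^sup>2" using t by simp
    ultimately show ?thesis by simp
  qed
  have small2: "2 * d\<^sup>2 \<le> t * K\<^sup>2" if t: "0 < t" "t < 1" for t
  proof -
    have "2 * t * d\<^sup>2 \<le> t\<^sup>2 * K\<^sup>2"
      by (rule field_le_epsilon) (use small[OF t] in \<open>simp add: add.commute\<close>)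
    then have "t * (2 * d\<^sup>2) \<le> t * (t * K\<^sup>2)" by (simp add: power2_eq_square algebra_simps)
    then show ?thesis using t by simp
  qed
  have "d = 0"
  proof (rule ccontr)
    assume "d \<noteq> 0"
    \<comment> \<open>This \<open>t\<close> lies strictly between 0 and 1 and satisfies
      \<open>t * K\<^sup>2 \<le> d\<^sup>2\<close>, which contradicts \<open>small2\<close>.\<close>
    moreover define t where "t = d\<^sup>2 / (K\<^sup>2 + d\<^sup>2)"
    have "K > 0" using d0 M norm_ge_zero[of p] by (simp add: K_def add_pos_nonneg)
    moreover have "t * K\<^sup>2 \<le> d\<^sup>2" using d0 \<open>K > 0\<close> by (simp add: t_def field_simps add_pos_nonneg)
    moreover have "0 < t" "t < 1" using \<open>d \<noteq> 0\<close> \<open>K > 0\<close> by (auto simp: t_def add_pos_pos)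
    ultimately have "2 * d\<^sup>2 \<le> d\<^sup>2" using small2 order_trans by blast
    with \<open>d \<noteq> 0\<close> show False by simp
  qed
  then show ?thesis using assms(1) C0 by (simp add: d_def in_closed_iff_infdist_zero)
qed

text \<open>If convergence failed against some \<open>z\<close>, a subsequence would keep its
  products with \<open>z\<close> away from \<open>inner z p\<close>, and so would its weakly
  convergent subsequences, whose limit is \<open>p\<close>.\<close>

lemma bounded_unique_weak_cluster_point_imp_weakly_tendsto:
  fixes u :: "nat \<Rightarrow> 'a::{real_inner, complete_space}"
  assumes M: "\<And>n. norm (u n) \<le> M"
    and uniq: "\<And>r q. strict_mono r \<Longrightarrow> weakly_tendsto (\<lambda>k. u (r k)) q \<Longrightarrow> q = p"
  shows "weakly_tendsto u p"
proof (rule ccontr)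
  assume "\<not> weakly_tendsto u p"
  then obtain z where "\<not> (\<lambda>k. inner z (u k)) \<longlonglongrightarrow> inner z p"
    by (auto simp: weakly_tendsto_def)
  then obtain e where "e > 0" and "\<forall>N. \<exists>n\<ge>N. e \<le> \<bar>inner z (u n) - inner z p\<bar>"
    unfolding LIMSEQ_iff by (auto simp: not_less)
  then have "infinite {n. e \<le> \<bar>inner z (u n) - inner z p\<bar>}"
    unfolding infinite_nat_iff_unbounded_le by blast
  then obtain r :: "nat \<Rightarrow> nat"
    where r: "strict_mono r" "\<And>n. e \<le> \<bar>inner z (u (r n)) - inner z p\<bar>"
    using infinite_enumerate by blast
  obtain s q where s: "strict_mono s" "weakly_tendsto (\<lambda>k. u (r (s k))) q"
    using bounded_imp_weakly_convergent_subsequence[of "\<lambda>k. u (r k)" M] M by auto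
  have "q = p" using uniq[of "r \<circ> s" q] r(1) s by (simp add: strict_mono_o)
  with s(2) have "(\<lambda>k. inner z (u (r (s k)))) \<longlonglongrightarrow> inner z p"
    by (simp add: weakly_tendsto_def)
  then have "(\<lambda>k. \<bar>inner z (u (r (s k))) - inner z p\<bar>) \<longlonglongrightarrow> \<bar>inner z p - inner z p\<bar>"
    by (intro tendsto_rabs tendsto_diff tendsto_const)
  then have "e \<le> \<bar>inner z p - inner z p\<bar>" using r(2) by (auto intro: LIMSEQ_le_const)
  with \<open>e > 0\<close> show False by simp
qed

text \<open>Infinitely many terms lie in one ball, where weak compactness applies.\<close>

lemma not_at_top_imp_weakly_convergent_subsequence:
  fixes u :: "nat \<Rightarrow> 'a::{real_inner, complete_space}"
  assumes "\<not> filterlim (\<lambda>k. norm (u k)) at_top sequentially"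
  shows "\<exists>r p. strict_mono r \<and> weakly_tendsto (\<lambda>k. u (r k)) p"
proof -
  obtain M where "\<forall>N. \<exists>n\<ge>N. norm (u n) \<le> M"
    using assms unfolding filterlim_at_top eventually_sequentially by (meson nle_le)
  then have "infinite {n. norm (u n) \<le> M}"
    unfolding infinite_nat_iff_unbounded_le by blast
  then obtain r :: "nat \<Rightarrow> nat" where r: "strict_mono r" "\<And>n. norm (u (r n)) \<le> M"
    using infinite_enumerate by blast
  obtain s q where s: "strict_mono s" "weakly_tendsto (\<lambda>k. u (r (s k))) q"
    using bounded_imp_weakly_convergent_subsequence[of "\<lambda>k. u (r k)" M] r by auto
  then show ?thesis using strict_mono_o[OF r(1) s(1)] by (auto simp: o_def)
qed

lemma tendsto_inner_bounded_null:
  fixes u v :: "nat \<Rightarrow> 'a::real_inner"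
  assumes M: "\<And>n. norm (u n) \<le> M" and v: "v \<longlonglongrightarrow> 0"
  shows "(\<lambda>k. inner (u k) (v k)) \<longlonglongrightarrow> 0"
proof (rule Lim_null_comparison)
  show "\<forall>\<^sub>F n in sequentially. norm (inner (u n) (v n)) \<le> M * norm (v n)"
  proof (intro always_eventually allI)
    fix n
    have "norm (inner (u n) (v n)) \<le> norm (u n) * norm (v n)"
      using Cauchy_Schwarz_ineq2 by simp
    also have "\<dots> \<le> M * norm (v n)" by (intro mult_right_mono M) simp
    finally show "norm (inner (u n) (v n)) \<le> M * norm (v n)" .
  qed
  show "(\<lambda>n. M * norm (v n)) \<longlonglongrightarrow> 0"
    using tendsto_mult_right_zero[OF tendsto_norm_zero[OF v]] by simp
qed

subsection \<open>Convex lower semicontinuous functions\<close>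

lemma closed_sublevel_lsc:
  fixes h :: "'a::topological_space \<Rightarrow> ereal"
  assumes "lsc h"
  shows "closed {z. h z \<le> c}"
proof -
  have "open {z. c < h z}"
  proof (subst open_subopen, intro ballI)
    fix z assume "z \<in> {z. c < h z}"
    then have "\<forall>\<^sub>F w in nhds z. c < h w"
      using assms unfolding lsc_def le_Liminf_iff by blast
    then show "\<exists>T. open T \<and> z \<in> T \<and> T \<subseteq> {z. c < h z}"
      unfolding eventually_nhds by blast
  qed
  moreover have "{z. h z \<le> c} = - {z. c < h z}" by auto
  ultimately show ?thesis by (simp add: closed_def)
qed

lemma convex_sublevel:
  assumes "convex_ereal h"
  shows "convex {z. h z \<le> ereal c}"
  unfolding convex_alt
proof (clarify)
  fix a b and t :: real
  assume ab: "h a \<le> ereal c" "h b \<le> ereal c" and t: "0 \<le> t" "t \<le> 1"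
  show "h ((1 - t) *\<^sub>R a + t *\<^sub>R b) \<le> ereal c"
  proof (cases "t = 0 \<or> t = 1")
    case False
    then have "h ((1 - t) *\<^sub>R a + t *\<^sub>R b) \<le> ereal (1 - t) * h a + ereal t * h b"
      using assms t unfolding convex_ereal_def by simp
    also have "\<dots> \<le> ereal (1 - t) * ereal c + ereal t * ereal c"
      using ab t by (intro add_mono ereal_mult_left_mono) auto
    also have "\<dots> = ereal c" by (simp add: algebra_simps)
    finally show ?thesis .
  qed (use ab in auto)
qed

text \<open>Sublevel sets are closed and convex, hence closed under weak limits of
  sequences.\<close>

lemma weakly_lsc:
  fixes h :: "'a::{real_inner, complete_space} \<Rightarrow> ereal"
  assumes "convex_ereal h" "lsc h" "weakly_tendsto u p"
    and "eventually (\<lambda>n. h (u n) \<le> ereal c) sequentially"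
  shows "h p \<le> ereal c"
  using closed_convex_imp_weakly_closed[OF closed_sublevel_lsc[OF assms(2)] convex_sublevel[OF assms(1)] _ assms(3), of c] assms(4)
  by simp

lemma argmin_iff: "p \<in> argmin h \<longleftrightarrow> (\<forall>z. h p \<le> h z)"
  by (auto simp: argmin_def is_arg_min_def not_less)

lemma argmin_INF: "p \<in> argmin h \<Longrightarrow> (INF z. h z) = h p"
  by (auto simp: argmin_iff intro!: antisym INF_greatest INF_lower)

text \<open>In the subgradient inequality at \<open>y k\<close> the inner product tends to 0,
  because \<open>y\<close> is bounded and \<open>v\<close> vanishes strongly. So
  \<open>h (y k)\<close> is eventually below every real number above \<open>h z\<close>; weak lower
  semicontinuity then yields minimality, and \<open>z = p\<close> yields convergence of the
  values.\<close>

lemma weak_limit_vanishing_subgradients: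
  fixes h :: "'a::{real_inner, complete_space} \<Rightarrow> ereal"
  assumes h: "proper_fun h" "convex_ereal h" "lsc h"
    and sub: "\<And>k. v k \<in> subdifferential h (y k)"
    and y: "weakly_tendsto y p" and v: "v \<longlonglongrightarrow> 0"
  shows "p \<in> argmin h" "(\<lambda>k. h (y k)) \<longlonglongrightarrow> h p"
proof -
  obtain M where M: "\<And>n. norm (y n) \<le> M" using weakly_tendsto_imp_bounded[OF y] by blast
  have null: "(\<lambda>k. inner (z - y k) (v k)) \<longlonglongrightarrow> 0" for z
  proof (rule tendsto_inner_bounded_null[OF _ v])
    show "norm (z - y k) \<le> norm z + M" for k
      using norm_triangle_ineq4[of z "y k"] M[of k] by linarith
  qed
  have upper: "\<forall>\<^sub>F k in sequentially. h (y k) < ereal c" if z: "h z < ereal c" for z c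
  proof -
    \<comment> \<open>The gap between \<open>b\<close> and \<open>c\<close> absorbs the inner
      product, which only has to exceed the negative number \<open>b - c\<close>.\<close>
    obtain b where b: "h z < ereal b" "b < c"
      using ereal_dense2[OF z] by auto
    have "\<forall>\<^sub>F k in sequentially. b - c < inner (z - y k) (v k)"
      using order_tendstoD(1)[OF null, of "b - c"] b by simp
    then show ?thesis
    proof eventually_elim
      case (elim k)
      have "h (y k) + ereal (inner (z - y k) (v k)) \<le> h z"
        using sub unfolding subdifferential_def by blast
      then have "h (y k) + ereal (inner (z - y k) (v k)) < ereal b"
        using b(1) by (rule order.strict_trans1)
      moreover have "a < ereal c" if "a + ereal i < ereal b" "b - c < i" for a i
        using that by (cases a) auto
      ultimately show ?case using elim by blast
    qed
  qed
  have min: "h p \<le> h z" for z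
  proof (rule ccontr)
    assume "\<not> h p \<le> h z"
    then have "h z < h p" by simp
    from ereal_dense2[OF this] obtain c where c: "h z < ereal c" "ereal c < h p" by blast
    then have "h p \<le> ereal c"
      by (intro weakly_lsc[OF h(2,3) y] eventually_mono[OF upper[OF c(1)]]) simp
    then show False using c by simp
  qed
  then show "p \<in> argmin h" by (simp add: argmin_iff)
  show "(\<lambda>k. h (y k)) \<longlonglongrightarrow> h p"
  proof (rule order_tendstoI)
    fix a assume "a < h p"
    show "\<forall>\<^sub>F k in sequentially. a < h (y k)"
      by (intro always_eventually allI order.strict_trans2[OF \<open>a < h p\<close> min])
  next
    fix a assume "h p < a"
    from ereal_dense2[OF this] obtain c where "h p < ereal c" "ereal c < a" by blast
    then show "\<forall>\<^sub>F k in sequentially. h (y k) < a"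
      by (intro eventually_mono[OF upper[of p c]]) simp_all
  qed
qed

subsection \<open>Real sequences\<close>

text \<open>Dividing by the partial products of \<open>1 + \<eta>\<^sub>k\<close> removes the factors \<open>1 + \<eta>\<^sub>k\<close>.\<close>
lemma almost_decreasing_sequence:
  fixes a b \<eta> \<epsilon> :: "nat \<Rightarrow> real"
  assumes nonneg: "\<And>k. 0 \<le> a k" "\<And>k. 0 \<le> b k" "\<And>k. 0 \<le> \<eta> k" "\<And>k. 0 \<le> \<epsilon> k"
    and summ: "summable \<eta>" "summable \<epsilon>"
    and step: "\<And>k. a (Suc k) \<le> (1 + \<eta> k) * a k - b k + \<epsilon> k"
  shows "convergent a" "summable b"
proof -
  define P where "P n = (\<Prod>j<n. 1 + \<eta> j)" for n
  have P_Suc: "P (Suc n) = P n * (1 + \<eta> n)" for n by (simp add: P_def)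
  have P1: "1 \<le> P n" for n unfolding P_def by (intro prod_ge_1) (simp add: nonneg)
  \<comment> \<open>By \<open>1 + s \<le> exp s\<close>, summability of \<open>\<eta>\<close> keeps
    the increasing products bounded.\<close>
  have Pmax: "P n \<le> exp (suminf \<eta>)" for n
  proof -
    have "P n \<le> (\<Prod>j<n. exp (\<eta> j))"
      unfolding P_def by (intro prod_mono) (auto simp: nonneg add_nonneg_nonneg)
    also have "\<dots> = exp (\<Sum>j<n. \<eta> j)" by (simp add: exp_sum)
    also have "\<dots> \<le> exp (suminf \<eta>)" using summ nonneg by (simp add: sum_le_suminf)
    finally show ?thesis .
  qed
  have "incseq P"
  proof (rule incseq_SucI)
    show "P n \<le> P (Suc n)" for n
      using P1[of n] nonneg(3)[of n] by (simp add: P_Suc algebra_simps)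
  qed
  then obtain Q where Q: "P \<longlonglongrightarrow> Q" using incseq_convergent Pmax by metis
  \<comment> \<open>The divisor is \<open>P (Suc k)\<close> because \<open>step\<close> bounds
    \<open>a (Suc k)\<close>; its last factor then cancels \<open>1 + \<eta> k\<close> and leaves
    \<open>a k / P k\<close>.\<close>
  define B where "B k = b k / P (Suc k)" for k
  define e where "e k = \<epsilon> k / P (Suc k)" for k
  have P0: "P n > 0" for n using P1[of n] by linarith
  have e: "0 \<le> e k" "e k \<le> \<epsilon> k" for k
    using nonneg(4)[of k] P0[of "Suc k"] P1[of "Suc k"]
    by (auto simp: e_def divide_le_eq mult_le_cancel_left1 intro: divide_nonneg_pos)
  have B0: "0 \<le> B k" for k using nonneg(2)[of k] P0[of "Suc k"] by (simp add: B_def)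
  have e_summable: "summable e"
    by (rule summable_comparison_test'[OF summ(2), of 0]) (use e in auto)
  \<comment> \<open>With the partial sums moved to this side, the divided recursion says that
    \<open>w\<close> decreases; it is bounded below by \<open>- suminf e\<close>.\<close>
  define w where "w n = a n / P n + (\<Sum>j<n. B j) - (\<Sum>j<n. e j)" for n
  have "decseq w"
  proof (rule decseq_SucI)
    fix n
    have "a (Suc n) / P (Suc n) \<le> ((1 + \<eta> n) * a n - b n + \<epsilon> n) / P (Suc n)"
      using step[of n] P0[of "Suc n"] by (intro divide_right_mono) auto
    also have "\<dots> = a n / P n - B n + e n"
      using P0[of n] nonneg(3)[of n]
      by (simp add: B_def e_def P_Suc add_divide_distrib diff_divide_distrib)
    finally show "w (Suc n) \<le> w n" by (simp add: w_def)
  qed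
  have ap: "0 \<le> a n / P n" for n using nonneg(1)[of n] P0[of n] by simp
  have e_le: "(\<Sum>j<n. e j) \<le> suminf e" for n
    using e_summable e by (intro sum_le_suminf) auto
  have "- suminf e \<le> w n" for n
    using ap[of n] e_le[of n] sum_nonneg[of "{..<n}" B] B0 by (simp add: w_def)
  then obtain l where l: "w \<longlonglongrightarrow> l" using decseq_convergent[OF \<open>decseq w\<close>] by metis
  have "summable B"
  proof (rule summableI_nonneg_bounded[OF B0])
    show "(\<Sum>j<n. B j) \<le> w 0 + suminf e" for n
      using decseqD[OF \<open>decseq w\<close>, of 0 n] ap[of n] e_le[of n] unfolding w_def by linarith
  qed
  have "(\<lambda>n. (w n - (\<Sum>j<n. B j) + (\<Sum>j<n. e j)) * P n) \<longlonglongrightarrow> (l - suminf B + suminf e) * Q"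
    by (intro tendsto_intros l Q summable_LIMSEQ e_summable \<open>summable B\<close>)
  moreover have "(w n - (\<Sum>j<n. B j) + (\<Sum>j<n. e j)) * P n = a n" for n
    using P0[of n] by (simp add: w_def)
  ultimately show "convergent a" by (auto simp: convergent_def)
  show "summable b"
  proof (rule summable_comparison_test'[of "\<lambda>k. exp (suminf \<eta>) * B k" 0])
    show "summable (\<lambda>k. exp (suminf \<eta>) * B k)" by (intro summable_mult \<open>summable B\<close>)
    fix k
    have "b k = P (Suc k) * B k" using P0[of "Suc k"] by (simp add: B_def)
    also have "\<dots> \<le> exp (suminf \<eta>) * B k" by (intro mult_right_mono Pmax B0)
    finally show "norm (b k) \<le> exp (suminf \<eta>) * B k" using nonneg(2)[of k] by simp
  qed
qed

text \<open>Olivier's theorem: the block from \<open>k div 2\<close> to \<open>k\<close> holds at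
  least half of the first \<open>k\<close> indices and its terms are at least \<open>d k\<close>, so
  \<open>k * d k\<close> is at most twice the tail of the series from \<open>k div 2\<close>
  on.\<close>

lemma decseq_summable_times_index:
  fixes d :: "nat \<Rightarrow> real"
  assumes "decseq d" "\<And>k. 0 \<le> d k" "summable d"
  shows "(\<lambda>k. real k * d k) \<longlonglongrightarrow> 0"
proof (rule tendsto_sandwich)
  show "\<forall>\<^sub>F k in sequentially. 0 \<le> real k * d k" using assms(2) by simp
  show "\<forall>\<^sub>F k in sequentially. real k * d k \<le> 2 * (suminf d - (\<Sum>j<k div 2. d j))"
  proof (intro always_eventually allI)
    fix k
    have "real (k - k div 2) * d k = (\<Sum>j\<in>{k div 2..<k}. d k)" by simp
    also have "\<dots> \<le> (\<Sum>j\<in>{k div 2..<k}. d j)"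
      by (intro sum_mono) (auto intro: decseqD[OF assms(1)])
    also have "\<dots> = (\<Sum>j<k. d j) - (\<Sum>j<k div 2. d j)"
      by (simp add: sum_diff_nat_ivl lessThan_atLeast0)
    also have "\<dots> \<le> suminf d - (\<Sum>j<k div 2. d j)"
      using assms by (simp add: sum_le_suminf)
    finally have "real (k - k div 2) * d k \<le> suminf d - (\<Sum>j<k div 2. d j)" .
    moreover have "real k \<le> 2 * real (k - k div 2)" by linarith
    then have "real k * d k \<le> 2 * (real (k - k div 2) * d k)"
      using mult_right_mono[OF _ assms(2)[of k]] by (simp only: mult.assoc[symmetric])
    ultimately show "real k * d k \<le> 2 * (suminf d - (\<Sum>j<k div 2. d j))" by argo
  qed
  have "filterlim (\<lambda>k::nat. k div 2) at_top sequentially"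
    unfolding filterlim_at_top eventually_sequentially
    by (metis div_le_mono nonzero_mult_div_cancel_left zero_neq_numeral)
  then have "(\<lambda>k. \<Sum>j<k div 2. d j) \<longlonglongrightarrow> suminf d"
    by (rule filterlim_compose[OF summable_LIMSEQ[OF assms(3)]])
  then have "(\<lambda>k. 2 * (suminf d - (\<Sum>j<k div 2. d j))) \<longlonglongrightarrow> 2 * (suminf d - suminf d)"
    by (intro tendsto_intros)
  then show "(\<lambda>k. 2 * (suminf d - (\<Sum>j<k div 2. d j))) \<longlonglongrightarrow> 0" by simp
qed simp

text \<open>A positive limit \<open>l\<close> of \<open>d\<close> would bound the partial sums of
  \<open>\<alpha>\<close> by the weighted sum divided by \<open>l\<close>.\<close>

lemma decseq_weighted_summable_imp_null:
  fixes d \<alpha> :: "nat \<Rightarrow> real"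
  assumes "decseq d" "\<And>k. 0 \<le> d k" "\<And>k. 0 \<le> \<alpha> k" "summable (\<lambda>k. \<alpha> k * d (Suc k))"
    and inf: "filterlim (\<lambda>n. \<Sum>k<n. \<alpha> k) at_top sequentially"
  shows "d \<longlonglongrightarrow> 0"
proof -
  obtain l where l: "d \<longlonglongrightarrow> l" "\<And>k. l \<le> d k" using decseq_convergent[OF assms(1)] assms(2) by metis
  have "l \<ge> 0" using l(1) assms(2) by (auto intro: LIMSEQ_le_const)
  moreover have "\<not> l > 0"
  proof
    assume "l > 0"
    have bound: "(\<Sum>k<n. \<alpha> k) \<le> (\<Sum>k. \<alpha> k * d (Suc k)) / l" for n
    proof -
      have "(\<Sum>k<n. \<alpha> k) * l \<le> (\<Sum>k<n. \<alpha> k * d (Suc k))"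
        unfolding sum_distrib_right by (intro sum_mono mult_left_mono l(2) assms(3))
      also have "\<dots> \<le> (\<Sum>k. \<alpha> k * d (Suc k))"
        using assms by (intro sum_le_suminf) auto
      finally show ?thesis using \<open>l > 0\<close> by (simp add: field_simps)
    qed
    have "\<forall>\<^sub>F n in sequentially. (\<Sum>k. \<alpha> k * d (Suc k)) / l + 1 \<le> (\<Sum>k<n. \<alpha> k)"
      using inf by (simp add: filterlim_at_top)
    then obtain n where "(\<Sum>k. \<alpha> k * d (Suc k)) / l + 1 \<le> (\<Sum>k<n. \<alpha> k)"
      by (auto dest: eventually_happens)
    then show False using bound[of n] by linarith
  qed
  ultimately show ?thesis using l(1) by simp
qed

subsection \<open>Variable Hilbert norms\<close>

text \<open>\<open>V\<close> inherits its symmetry from \<open>B\<close>, and it respects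
  differences because a vector orthogonal to every \<open>a\<close> is zero.\<close>

lemma associated_operatorD:
  fixes V :: "'a::real_inner \<Rightarrow> 'a"
  assumes "associated_operator N V"
  shows "(N z)\<^sup>2 = inner z (V z)"
    "inner z (V w) = inner w (V z)" "V (z - w) = V z - V w"
proof -
  obtain B where B: "bilinear B" "\<And>x y. B x y = B y x" "\<And>x. 0 \<le> B x x"
      "\<And>x. B x x = 0 \<longleftrightarrow> x = 0" "\<And>x. N x = sqrt (B x x)" "\<And>x y. B x y = inner x (V y)"
    using assms unfolding associated_operator_def induces_norm_def is_scalar_product_def by blast
  show "(N z)\<^sup>2 = inner z (V z)" for z using B by (metis real_sqrt_pow2)
  show "inner z (V w) = inner w (V z)" using B by metis
  have "inner a (V (z - w)) = inner a (V z - V w)" for a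
    using B(1) by (simp add: B(6)[symmetric] inner_diff_right bilinear_rsub)
  then show "V (z - w) = V z - V w" by (metis inner_eq_zero_iff inner_diff_right eq_iff_diff_eq_0)
qed

text \<open>Opial's argument: for two such points the difference of the squared distances shows that
  \<open>\<langle>u\<^sub>k | W (p - q)\<rangle>\<close> converges, \<open>W\<close> being the strong limit of the \<open>V\<^sub>k\<close>.\<close>
lemma variable_metric_weak_cluster_point_unique:
  fixes V :: "nat \<Rightarrow> 'a::real_inner \<Rightarrow> 'a"
  assumes V: "\<And>k. associated_operator (N k) (V k)" and conv: "\<And>z. convergent (\<lambda>k. V k z)"
    and \<nu>: "\<nu> > 0" "\<And>k z. \<nu> * (norm z)\<^sup>2 \<le> (N k z)\<^sup>2"
    and M: "\<And>n. norm (u n) \<le> M"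
    and cp: "convergent (\<lambda>k. (N k (u k - p))\<^sup>2)" and cq: "convergent (\<lambda>k. (N k (u k - q))\<^sup>2)"
    and r: "strict_mono r" "weakly_tendsto (\<lambda>k. u (r k)) p"
    and s: "strict_mono s" "weakly_tendsto (\<lambda>k. u (s k)) q"
  shows "p = q"
proof -
  obtain W where W: "(\<lambda>k. V k (p - q)) \<longlonglongrightarrow> W" using conv by (auto simp: convergent_def)
  \<comment> \<open>The terms quadratic in \<open>u k\<close> cancel; by symmetry of
    \<open>V k\<close> what remains is affine in \<open>u k\<close>.\<close>
  have expand: "(N k (u k - p))\<^sup>2 - (N k (u k - q))\<^sup>2
      = inner p (V k p) - inner q (V k q) - 2 * inner (u k) (V k (p - q))" for k
    using associated_operatorD(2)[OF V[of k], of p "u k"] associated_operatorD(2)[OF V[of k], of q "u k"]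
    by (simp add: associated_operatorD(1,3)[OF V] inner_diff_left inner_diff_right)
  have "convergent (\<lambda>k. inner c (V k c))" for c
    using conv[of c] tendsto_inner[OF tendsto_const] unfolding convergent_def by metis
  then have "convergent (\<lambda>k. ((inner p (V k p) - inner q (V k q)) - ((N k (u k - p))\<^sup>2 - (N k (u k - q))\<^sup>2)) * (1/2))"
    by (intro convergent_mult convergent_diff convergent_const cp cq)
  then have "convergent (\<lambda>k. inner (u k) (V k (p - q)))" by (simp add: expand)
  \<comment> \<open>Strong convergence of \<open>V k (p - q)\<close> against the bounded
    \<open>u\<close> replaces the varying vector by the fixed \<open>W\<close>, so that weak limits
    along \<open>r\<close> and \<open>s\<close> can be taken.\<close>
  moreover have "(\<lambda>k. inner (u k) (V k (p - q) - W)) \<longlonglongrightarrow> 0"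
    by (rule tendsto_inner_bounded_null[OF M]) (use W in \<open>simp add: LIM_zero\<close>)
  ultimately have "convergent (\<lambda>k. inner (u k) (V k (p - q)) - inner (u k) (V k (p - q) - W))"
    by (intro convergent_diff) (auto simp: convergent_def)
  then obtain l where l: "(\<lambda>k. inner W (u k)) \<longlonglongrightarrow> l"
    by (auto simp: convergent_def inner_diff_right inner_commute)
  have "inner W p = l"
    using LIMSEQ_subseq_LIMSEQ[OF l r(1)] r(2)
    by (auto simp: weakly_tendsto_def o_def intro: LIMSEQ_unique)
  moreover have "inner W q = l"
    using LIMSEQ_subseq_LIMSEQ[OF l s(1)] s(2)
    by (auto simp: weakly_tendsto_def o_def intro: LIMSEQ_unique)
  ultimately have "inner (p - q) W = 0" by (simp add: inner_diff_right inner_commute[of "p - q" W])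
  \<comment> \<open>The uniform lower bound \<open>\<nu>\<close> survives in the limit, so
    \<open>inner (p - q) W = 0\<close> forces \<open>p = q\<close>.\<close>
  moreover have "(\<lambda>k. inner (p - q) (V k (p - q))) \<longlonglongrightarrow> inner (p - q) W"
    by (intro tendsto_inner W tendsto_const)
  then have "\<nu> * (norm (p - q))\<^sup>2 \<le> inner (p - q) W"
    using \<nu>(2) associated_operatorD(1)[OF V] by (auto intro: LIMSEQ_le_const)
  ultimately have "(norm (p - q))\<^sup>2 \<le> 0" using \<nu>(1) by (simp add: mult_le_0_iff)
  then show ?thesis by simp
qed

subsection \<open>Convergence of the descent sequence\<close>

theorem theorem3p10:
  fixes N :: "nat \<Rightarrow> 'a::{real_inner, complete_space} \<Rightarrow> real"
    and V :: "nat \<Rightarrow> 'a \<Rightarrow> 'a"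
    and h :: "'a \<Rightarrow> ereal"
    and x y :: "nat \<Rightarrow> 'a"
    and \<alpha> :: "nat \<Rightarrow> real"
  assumes "\<And>k. hilbert_norm (N k)"
    and "\<And>k. associated_operator (N k) (V k)"
    and "\<And>z. convergent (\<lambda>k. V k z)"
    and "\<exists>\<nu>>0. \<forall>k z. \<nu> * (norm z)\<^sup>2 \<le> (N k z)\<^sup>2"
    and "proper_fun h" and "convex_ereal h" and "lsc h"
    and "\<And>k. x k \<in> edom h"
    and A: "decseq (\<lambda>k. h (x k))"
    and B: "(INF k. h (x k)) > -\<infinity> \<Longrightarrow>
      (\<forall>k. \<alpha> k > 0) \<and> bdd_above (range \<alpha>) \<and>
      (\<exists>\<eta> \<epsilon> :: nat \<Rightarrow> real.
         (\<forall>k. \<eta> k \<ge> 0) \<and> summable \<eta> \<and> (\<forall>k. \<epsilon> k \<ge> 0) \<and> summable \<epsilon> \<and>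
         (\<forall>z\<in>edom h. \<forall>k.
            ereal ((N (Suc k) (x (Suc k) - z))\<^sup>2)
              \<le> ereal ((1 + \<eta> k) * (N k (x k - z))\<^sup>2)
                + ereal (2 * \<alpha> k) * (h z - h (x (Suc k))) + ereal (\<epsilon> k)))"
    and C: "(INF k. h (x k)) > -\<infinity> \<Longrightarrow>
      (\<exists>v :: nat \<Rightarrow> 'a.
         (\<forall>k. v k \<in> subdifferential h (y k)) \<and>
         (\<forall>r :: nat \<Rightarrow> nat. strict_mono r \<and> (\<exists>p. weakly_tendsto (\<lambda>k. x (r k)) p) \<longrightarrow>
            weakly_tendsto (\<lambda>k. x (r k) - y (r k)) 0 \<and> (\<lambda>k. v (r k)) \<longlonglongrightarrow> 0))"
  shows "((INF k. h (x k)) > -\<infinity> \<longrightarrow> summable (\<lambda>k. (norm (x (Suc k) - x k))\<^sup>2))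
    \<and> (argmin h \<noteq> {} \<longrightarrow>
          (\<exists>p\<in>argmin h. weakly_tendsto x p \<and> weakly_tendsto y p)
        \<and> (\<lambda>k. h (y k)) \<longlonglongrightarrow> (INF z. h z)
        \<and> (filterlim (\<lambda>n. \<Sum>k<n. \<alpha> k) at_top sequentially \<longrightarrow> (\<lambda>k. h (x k)) \<longlonglongrightarrow> (INF z. h z))
        \<and> ((INF k. ereal (\<alpha> k)) > 0 \<longrightarrow>
             (\<lambda>k. real_of_ereal (h (x k) - (INF z. h z))) \<in> o(\<lambda>k. 1 / real k)))
    \<and> (argmin h = {} \<longrightarrow>
          filterlim (\<lambda>k. norm (x k)) at_top sequentially
        \<and> (\<lambda>k. h (x k)) \<longlonglongrightarrow> (INF z. h z))"
proof -

  \<comment> \<open>Real-valued form of the hypotheses, quasi-Fejer monotonicity, weak cluster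
    points\<close>
  note V = assms(2) and conv = assms(3) and h = assms(5-7)
  obtain \<nu> where \<nu>: "\<nu> > 0" "\<And>k z. \<nu> * (norm z)\<^sup>2 \<le> (N k z)\<^sup>2" using assms(4) by blast
  \<comment> \<open>\<open>real_of_ereal\<close> sends infinity to 0, so \<open>H\<close> represents
    \<open>h\<close> only where \<open>h\<close> is finite; hence the guard
    \<open>h z < \<infinity>\<close> in \<open>fin\<close> and \<open>descent\<close>.\<close>
  define H where "H z = real_of_ereal (h z)" for z
  have fin: "h z = ereal (H z)" if "h z < \<infinity>" for z
    using that h(1) by (cases "h z") (auto simp: proper_fun_def H_def)
  have hx: "h (x k) = ereal (H (x k))" for k using assms(8)[of k] by (intro fin) (simp add: edom_def)
  have decH: "decseq (\<lambda>k. H (x k))" using A by (simp add: decseq_def hx)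
  define bdd where "bdd \<longleftrightarrow> (INF k. h (x k)) > -\<infinity>"
  \<comment> \<open>(B) in real numbers, with the values of \<open>h\<close> in a subtracted term,
    as \<open>almost_decreasing_sequence\<close> expects.\<close>
  have descent: "\<exists>\<eta> \<epsilon>. (\<forall>k. 0 \<le> \<eta> k) \<and> summable \<eta> \<and> (\<forall>k. 0 \<le> \<epsilon> k) \<and> summable \<epsilon> \<and>
      (\<forall>z k. h z < \<infinity> \<longrightarrow> (N (Suc k) (x (Suc k) - z))\<^sup>2
        \<le> (1 + \<eta> k) * (N k (x k - z))\<^sup>2 - 2 * (\<alpha> k * (H (x (Suc k)) - H z)) + \<epsilon> k)"
    if bdd: bdd
  proof -
    obtain \<eta> \<epsilon> where e: "\<forall>k. 0 \<le> \<eta> k" "summable \<eta>" "\<forall>k. 0 \<le> \<epsilon> k" "summable \<epsilon>"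
      and st: "\<And>z k. z \<in> edom h \<Longrightarrow> ereal ((N (Suc k) (x (Suc k) - z))\<^sup>2)
              \<le> ereal ((1 + \<eta> k) * (N k (x k - z))\<^sup>2)
                + ereal (2 * \<alpha> k) * (h z - h (x (Suc k))) + ereal (\<epsilon> k)"
      using B bdd unfolding bdd_def by blast
    have "(N (Suc k) (x (Suc k) - z))\<^sup>2
        \<le> (1 + \<eta> k) * (N k (x k - z))\<^sup>2 - 2 * (\<alpha> k * (H (x (Suc k)) - H z)) + \<epsilon> k"
      if z: "h z < \<infinity>" for z k
    proof -
      have "z \<in> edom h" using z by (simp add: edom_def)
      from st[OF this, of k] have "(N (Suc k) (x (Suc k) - z))\<^sup>2
          \<le> (1 + \<eta> k) * (N k (x k - z))\<^sup>2 + 2 * \<alpha> k * (H z - H (x (Suc k))) + \<epsilon> k"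
        unfolding fin[OF z] hx by simp
      then show ?thesis by (simp add: algebra_simps)
    qed
    with e show ?thesis by blast
  qed
  have \<alpha>_pos: "\<alpha> k > 0" if bdd for k using B that by (simp add: bdd_def)
  \<comment> \<open>\<open>z\<close> is only required to lie below all values along the sequence.
    This covers minimizers and also, when there are none, a hypothetical point with
    \<open>h z\<close> below the infimum along \<open>x\<close>.\<close>
  have fejer: "convergent (\<lambda>k. (N k (x k - z))\<^sup>2)" "summable (\<lambda>k. \<alpha> k * (H (x (Suc k)) - H z))"
      "\<exists>M. \<forall>k. norm (x k) \<le> M"
    if bdd and le: "\<And>k. h z \<le> h (x k)" for z
  proof -
    have z: "h z < \<infinity>" using le[of 0] by (rule le_less_trans) (simp add: hx)
    have Hle: "H z \<le> H (x k)" for k using le[of k] by (simp add: hx fin[OF z])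
    obtain \<eta> \<epsilon> where e: "\<And>k. 0 \<le> \<eta> k" "summable \<eta>" "\<And>k. 0 \<le> \<epsilon> k" "summable \<epsilon>"
      and st: "\<And>k. (N (Suc k) (x (Suc k) - z))\<^sup>2
        \<le> (1 + \<eta> k) * (N k (x k - z))\<^sup>2 - 2 * (\<alpha> k * (H (x (Suc k)) - H z)) + \<epsilon> k"
      using descent[OF \<open>bdd\<close>] z by metis
    have b: "0 \<le> 2 * (\<alpha> k * (H (x (Suc k)) - H z))" for k
      using \<alpha>_pos[OF \<open>bdd\<close>, of k] Hle[of "Suc k"] by simp
    note ads = almost_decreasing_sequence[OF zero_le_power2 b e(1,3,2,4) st]
    show cv: "convergent (\<lambda>k. (N k (x k - z))\<^sup>2)" by (rule ads)
    show "summable (\<lambda>k. \<alpha> k * (H (x (Suc k)) - H z))"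
      using summable_mult[OF ads(2), of "1/2"] by simp
    obtain K where K: "\<And>k. (N k (x k - z))\<^sup>2 \<le> K"
      using convergent_imp_Bseq[OF cv] by (auto simp: Bseq_def)
    have "norm (x k) \<le> sqrt (K / \<nu>) + norm z" for k
    proof -
      have "\<nu> * (norm (x k - z))\<^sup>2 \<le> K" using \<nu>(2) K order_trans by blast
      then have "(norm (x k - z))\<^sup>2 \<le> K / \<nu>" using \<nu>(1) by (simp add: field_simps)
      then have "norm (x k - z) \<le> sqrt (K / \<nu>)" by (rule real_le_rsqrt)
      then show ?thesis using norm_triangle_sub[of "x k" z] by linarith
    qed
    then show "\<exists>M. \<forall>k. norm (x k) \<le> M" by blast
  qed
  \<comment> \<open>(C) transfers the weak limit from \<open>x\<close> to \<open>y\<close> along the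
    subsequence, where the subgradients vanish.\<close>
  have cluster: "weakly_tendsto (\<lambda>k. y (r k)) p" "p \<in> argmin h" "(\<lambda>k. h (y (r k))) \<longlonglongrightarrow> h p"
    if bdd and r: "strict_mono r" "weakly_tendsto (\<lambda>k. x (r k)) p" for r p
  proof -
    obtain v where v: "\<And>k. v k \<in> subdifferential h (y k)"
      and vr: "weakly_tendsto (\<lambda>k. x (r k) - y (r k)) 0" "(\<lambda>k. v (r k)) \<longlonglongrightarrow> 0"
      using C \<open>bdd\<close> r unfolding bdd_def by blast
    show yr: "weakly_tendsto (\<lambda>k. y (r k)) p"
      unfolding weakly_tendsto_def
    proof
      fix z
      have "(\<lambda>k. inner z (x (r k)) - inner z (x (r k) - y (r k))) \<longlonglongrightarrow> inner z p - inner z 0"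
        using r(2) vr(1) unfolding weakly_tendsto_def by (intro tendsto_diff) auto
      then show "(\<lambda>k. inner z (y (r k))) \<longlonglongrightarrow> inner z p" by (simp add: inner_diff_right)
    qed
    show "p \<in> argmin h" "(\<lambda>k. h (y (r k))) \<longlonglongrightarrow> h p"
      by (rule weak_limit_vanishing_subgradients[OF h v yr vr(2)])+
  qed
  have lim_INF: "(\<lambda>k. h (x k)) \<longlonglongrightarrow> (INF k. h (x k))" using A by (rule LIMSEQ_INF)

  \<comment> \<open>Square-summability of the increments\<close>
  have "summable (\<lambda>k. (norm (x (Suc k) - x k))\<^sup>2)" if bdd: bdd
  proof -
    obtain \<eta> \<epsilon> where e: "summable \<epsilon>"
      and st: "\<And>z k. h z < \<infinity> \<Longrightarrow> (N (Suc k) (x (Suc k) - z))\<^sup>2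
        \<le> (1 + \<eta> k) * (N k (x k - z))\<^sup>2 - 2 * (\<alpha> k * (H (x (Suc k)) - H z)) + \<epsilon> k"
      using descent[OF bdd] by blast
    obtain K where K: "\<And>k. \<alpha> k \<le> K" using B bdd unfolding bdd_def bdd_above_def by blast
    obtain c where c: "ereal c < (INF k. h (x k))"
      using ereal_dense2[OF bdd[unfolded bdd_def]] by blast
    have "c \<le> H (x k)" for k using less_INF_D[OF c, of k] by (simp add: hx)
    then obtain l where l: "(\<lambda>k. H (x k)) \<longlonglongrightarrow> l" using decseq_convergent[OF decH] by metis
    \<comment> \<open>For \<open>z = x k\<close> the first term of \<open>st\<close> vanishes and
      \<open>2 * \<alpha> k\<close> times a decrease of \<open>H\<close> remains; with
      \<open>\<alpha> k \<le> K\<close> these decreases telescope, and dividing by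
      \<open>\<nu>\<close> returns to the original norm.\<close>
    define b where "b k = (2 * K * (H (x k) - H (x (Suc k))) + \<epsilon> k) / \<nu>" for k
    have "summable b"
      unfolding b_def by (intro summable_divide summable_add summable_mult telescope_summable'[OF l] e)
    moreover have "(norm (x (Suc k) - x k))\<^sup>2 \<le> b k" for k
    proof -
      have "\<nu> * (norm (x (Suc k) - x k))\<^sup>2 \<le> (N (Suc k) (x (Suc k) - x k))\<^sup>2" by (rule \<nu>)
      also have "\<dots> \<le> 2 * (\<alpha> k * (H (x k) - H (x (Suc k)))) + \<epsilon> k"
        using st[of "x k" k] associated_operatorD(1)[OF V, of k 0] by (simp add: hx algebra_simps)
      also have "\<dots> \<le> 2 * (K * (H (x k) - H (x (Suc k)))) + \<epsilon> k"
        using decseq_SucD[OF decH, of k] by (simp add: mult_right_mono K)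
      finally show ?thesis using \<nu>(1) by (simp add: b_def field_simps)
    qed
    ultimately show ?thesis
      using summable_comparison_test'[of b 0 "\<lambda>k. (norm (x (Suc k) - x k))\<^sup>2"] by simp
  qed

  \<comment> \<open>Weak convergence and rates when minimizers exist\<close>
  moreover have "(\<exists>p\<in>argmin h. weakly_tendsto x p \<and> weakly_tendsto y p)
        \<and> (\<lambda>k. h (y k)) \<longlonglongrightarrow> (INF z. h z)
        \<and> (filterlim (\<lambda>n. \<Sum>k<n. \<alpha> k) at_top sequentially \<longrightarrow> (\<lambda>k. h (x k)) \<longlonglongrightarrow> (INF z. h z))
        \<and> ((INF k. ereal (\<alpha> k)) > 0 \<longrightarrow>
             (\<lambda>k. real_of_ereal (h (x k) - (INF z. h z))) \<in> o(\<lambda>k. 1 / real k))"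
    if nonempty: "argmin h \<noteq> {}"
  proof -
    obtain z where z: "z \<in> argmin h" using nonempty by blast
    then have min: "\<And>w. h z \<le> h w" by (simp add: argmin_iff)
    have "h z < \<infinity>" using min[of "x 0"] by (rule le_less_trans) (simp add: hx)
    then have hz: "h z = ereal (H z)" by (rule fin)
    have INF_eq: "(INF w. h w) = ereal (H z)" using argmin_INF[OF z] hz by simp
    \<comment> \<open>A minimizer bounds the values along \<open>x\<close> from below, which makes
      (B) and (C) available.\<close>
    have "ereal (H z) \<le> (INF k. h (x k))" using min hz by (intro INF_greatest) simp
    then have bdd unfolding bdd_def by (rule less_le_trans[rotated]) simp
    obtain M where M: "\<And>k. norm (x k) \<le> M" using fejer(3)[OF \<open>bdd\<close> min] by blast
    have cv: "convergent (\<lambda>k. (N k (x k - w))\<^sup>2)" if "w \<in> argmin h" for w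
      using fejer(1)[OF \<open>bdd\<close>] that by (simp add: argmin_iff)
    obtain s p where s: "strict_mono s" "weakly_tendsto (\<lambda>k. x (s k)) p"
      using bounded_imp_weakly_convergent_subsequence M by blast
    have p: "p \<in> argmin h" using cluster(2)[OF \<open>bdd\<close> s] .
    have xp: "weakly_tendsto x p"
    proof (rule bounded_unique_weak_cluster_point_imp_weakly_tendsto[OF M])
      fix r q assume r: "strict_mono r" "weakly_tendsto (\<lambda>k. x (r k)) q"
      have "q \<in> argmin h" using cluster(2)[OF \<open>bdd\<close> r] .
      then show "q = p"
        using variable_metric_weak_cluster_point_unique[OF V conv \<nu> M cv cv r s] p by blast
    qed
    \<comment> \<open>The whole sequence is treated as a subsequence of itself through the
      identity.\<close>
    have yp: "weakly_tendsto y p" "(\<lambda>k. h (y k)) \<longlonglongrightarrow> h p"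
      using cluster(1,3)[OF \<open>bdd\<close> strict_mono_id, of p] xp by simp_all
    \<comment> \<open>(B) at index \<open>k\<close> controls the value at \<open>x (Suc k)\<close>,
      so \<open>\<alpha> k\<close> is paired with \<open>d (Suc k)\<close>.\<close>
    define d where "d k = H (x k) - H z" for k
    have d: "decseq d" "\<And>k. 0 \<le> d k" "summable (\<lambda>k. \<alpha> k * d (Suc k))"
    proof -
      show "decseq d" using decH by (simp add: d_def decseq_def)
      show "0 \<le> d k" for k using min[of "x k"] by (simp add: d_def hx hz)
      show "summable (\<lambda>k. \<alpha> k * d (Suc k))" using fejer(2)[OF \<open>bdd\<close> min] by (simp add: d_def)
    qed
    have "(\<lambda>k. h (x k)) \<longlonglongrightarrow> (INF z. h z)"
      if "filterlim (\<lambda>n. \<Sum>k<n. \<alpha> k) at_top sequentially"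
    proof -
      have "d \<longlonglongrightarrow> 0"
        using decseq_weighted_summable_imp_null[OF d(1,2) _ d(3) that] \<alpha>_pos[OF \<open>bdd\<close>]
        by (simp add: less_imp_le)
      then have "(\<lambda>k. d k + H z) \<longlonglongrightarrow> 0 + H z" by (intro tendsto_add tendsto_const)
      then show ?thesis by (simp add: d_def hx INF_eq)
    qed
    moreover have "(\<lambda>k. real_of_ereal (h (x k) - (INF z. h z))) \<in> o(\<lambda>k. 1 / real k)"
      if inf_pos: "(INF k. ereal (\<alpha> k)) > 0"
    proof -
      obtain c where c: "0 < ereal c" "ereal c < (INF k. ereal (\<alpha> k))"
        using ereal_dense2[OF inf_pos] by blast
      have c\<alpha>: "c \<le> \<alpha> k" for k using less_INF_D[OF c(2), of k] by simp
      \<comment> \<open>A positive lower bound for the weights turns weighted summability into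
        summability of \<open>d\<close>.\<close>
      have "norm (d (Suc k)) \<le> \<alpha> k * d (Suc k) / c" for k
        using c(1) d(2)[of "Suc k"] mult_right_mono[OF c\<alpha>[of k] d(2)[of "Suc k"]] by (simp add: field_simps)
      then have "summable (\<lambda>k. d (Suc k))"
        by (rule summable_comparison_test'[OF summable_divide[OF d(3)], of 0 _ c])
      then have "summable d" by (simp add: summable_Suc_iff)
      then have "(\<lambda>k. real k * d k) \<longlonglongrightarrow> 0" by (rule decseq_summable_times_index[OF d(1,2)])
      \<comment> \<open>The quotient is \<open>k * d k\<close>; it is formed from index 1 on, since
        \<open>1 / real 0\<close> is 0.\<close>
      then have "d \<in> o(\<lambda>k. 1 / real k)"
        by (intro smalloI_tendsto) (auto simp: mult.commute eventually_sequentially intro!: exI[of _ 1])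
      then show ?thesis by (simp add: hx INF_eq d_def[abs_def])
    qed
    ultimately show ?thesis using p xp yp argmin_INF[OF p] by auto
  qed

  \<comment> \<open>Divergence in norm when there are no minimizers\<close>
  moreover have "filterlim (\<lambda>k. norm (x k)) at_top sequentially \<and> (\<lambda>k. h (x k)) \<longlonglongrightarrow> (INF z. h z)"
    if S: "argmin h = {}"
  proof -
    have top: "filterlim (\<lambda>k. norm (x k)) at_top sequentially"
    proof (rule ccontr)
      assume "\<not> ?thesis"
      then obtain r p where r: "strict_mono r" "weakly_tendsto (\<lambda>k. x (r k)) p"
        using not_at_top_imp_weakly_convergent_subsequence by blast
      show False
      proof (cases bdd)
        case True
        then show False using cluster(2)[OF _ r] S by blast
      next
        case False
        \<comment> \<open>Without (B) and (C), the contradiction comes from properness: weak lower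
          semicontinuity pushes \<open>h p\<close> below every real number.\<close>
        then have "(\<lambda>k. h (x (r k))) \<longlonglongrightarrow> -\<infinity>"
          using LIMSEQ_subseq_LIMSEQ[OF lim_INF r(1)] by (simp add: bdd_def o_def)
        then have "\<forall>\<^sub>F k in sequentially. h (x (r k)) < ereal c" for c
          by (rule order_tendstoD) simp
        then have "h p \<le> ereal c" for c
          by (intro weakly_lsc[OF h(2,3) r(2)]) (rule eventually_mono[OF _ less_imp_le])
        then have "h p = -\<infinity>" by (rule ereal_bot)
        then show False using h(1) by (simp add: proper_fun_def)
      qed
    qed
    have "(INF k. h (x k)) \<le> h z" for z
    proof (rule ccontr)
      assume "\<not> (INF k. h (x k)) \<le> h z"
      then have z: "h z < (INF k. h (x k))" by simp
      \<comment> \<open>An infimum strictly above \<open>h z\<close> cannot be minus infinity, so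
        \<open>fejer\<close> applies and bounds \<open>x\<close>.\<close>
      then have bdd unfolding bdd_def by (rule le_less_trans[rotated]) simp
      moreover have "h z \<le> h (x k)" for k using less_INF_D[OF z, of k] by simp
      ultimately obtain M where M: "\<And>k. norm (x k) \<le> M" using fejer(3) by blast
      have "\<forall>\<^sub>F k in sequentially. M + 1 \<le> norm (x k)" using top by (simp add: filterlim_at_top)
      then obtain k where "M + 1 \<le> norm (x k)" by (auto dest: eventually_happens)
      then show False using M[of k] by linarith
    qed
    then have "(INF z. h z) = (INF k. h (x k))"
      by (intro antisym INF_greatest) (auto intro: INF_lower)
    then show ?thesis using top lim_INF by simp
  qed

  ultimately show ?thesis unfolding bdd_def by blast
qed

end
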